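(* Let $R$ be a finite commutative local ring with unity. Then: (i) If $|U(R)|=1$, then $\mathrm{sdim}(\mathrm{Cl}(R))=1$. (ii) If $|U(R)|\ge 2$, then $\mathrm{sdim}(\mathrm{Cl}(R))=2|U(R)|-2$.
   Context: $U(R)$ is the set of units, $\mathrm{Id}(R)$ the set of idempotents. The clean graph $\mathrm{Cl}(R)$ has vertex set $\{(e,u): e\in\mathrm{Id}(R), u\in U(R)\}$, two distinct vertices $(e,u),(f,v)$ being adjacent iff $ef=0$ or $uv=1$. In a graph, a vertex $w$ strongly resolves vertices $x,y$ if some shortest $x$–$w$ path contains $y$ or some shortest $y$–$w$ path contains $x$; a strong resolving set is a set $S$ of vertices such that every two distinct vertices are strongly resolved by some vertex of $S$; $\mathrm{sdim}$ is the smallest cardinality of a strong resolving set. *)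

theory Defs
  imports
    "HOL-Algebra.Ideal"
    "Graph_Theory.Pair_Digraph"
    "Graph_Theory.Vertex_Walk"
begin

text \<open>The zero ring is excluded, since it has no maximal ideal.\<close>

locale local_cring = cring +
  assumes unique_maximalideal: "\<exists>!M. maximalideal M R"

definition idempotents :: "('a, 'b) ring_scheme \<Rightarrow> 'a set" where
  "idempotents R = {e \<in> carrier R. e \<otimes>\<^bsub>R\<^esub> e = e}"

text \<open>A simple graph is represented by its symmetric loop-free set of arcs
  (cf. the lemma \<open>pair_graph_clean_graph\<close> below).\<close>

definition clean_graph :: "('a, 'b) ring_scheme \<Rightarrow> ('a \<times> 'a) pair_pre_digraph" where
  "clean_graph R =
    \<lparr> pverts = idempotents R \<times> Units R,
      parcs = {((e, u), (f, v)) | e u f v.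
        e \<in> idempotents R \<and> u \<in> Units R \<and> f \<in> idempotents R \<and> v \<in> Units R \<and>
        (e, u) \<noteq> (f, v) \<and> (e \<otimes>\<^bsub>R\<^esub> f = \<zero>\<^bsub>R\<^esub> \<or> u \<otimes>\<^bsub>R\<^esub> v = \<one>\<^bsub>R\<^esub>)} \<rparr>"

definition shortest_vpath :: "('a, 'b) pre_digraph \<Rightarrow> 'a \<Rightarrow> 'a vwalk \<Rightarrow> 'a \<Rightarrow> bool" where
  "shortest_vpath G x p y \<longleftrightarrow>
    vpath p G \<and> hd p = x \<and> last p = y \<and>
    (\<forall>q. vpath q G \<and> hd q = x \<and> last q = y \<longrightarrow> vwalk_length p \<le> vwalk_length q)"

definition strongly_resolves :: "('a, 'b) pre_digraph \<Rightarrow> 'a \<Rightarrow> 'a \<Rightarrow> 'a \<Rightarrow> bool" where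
  "strongly_resolves G w x y \<longleftrightarrow>
    (\<exists>p. shortest_vpath G x p w \<and> y \<in> set p) \<or> (\<exists>p. shortest_vpath G y p w \<and> x \<in> set p)"

definition strong_resolving_set :: "('a, 'b) pre_digraph \<Rightarrow> 'a set \<Rightarrow> bool" where
  "strong_resolving_set G S \<longleftrightarrow>
    S \<subseteq> verts G \<and>
    (\<forall>x \<in> verts G. \<forall>y \<in> verts G. x \<noteq> y \<longrightarrow> (\<exists>w \<in> S. strongly_resolves G w x y))"

text \<open>Meaningful only for graphs with a finite strong resolving set, in particular for all
  finite graphs; the finiteness condition is needed as \<open>card\<close> is 0 on infinite sets.\<close>

definition sdim :: "('a, 'b) pre_digraph \<Rightarrow> nat" where
  "sdim G = (LEAST k. \<exists>S. strong_resolving_set G S \<and> finite S \<and> card S = k)"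

lemma pair_graph_clean_graph:
  assumes "cring R" and "finite (carrier R)"
  shows "pair_graph (clean_graph R)"
proof -
  interpret cring R by fact
  have fin: "finite (pverts (clean_graph R))"
    using assms(2) by (auto simp: clean_graph_def idempotents_def Units_def)
  have sub: "parcs (clean_graph R) \<subseteq> pverts (clean_graph R) \<times> pverts (clean_graph R)"
    by (auto simp: clean_graph_def)
  show ?thesis
  proof unfold_locales
    show "finite (parcs (clean_graph R))"
      using fin sub by (meson finite_SigmaI finite_subset)
    show "symmetric (with_proj (clean_graph R))"
      by (auto simp: symmetric_def sym_def clean_graph_def idempotents_def m_comm Units_closed)
  qed (use fin sub in \<open>auto simp: clean_graph_def\<close>)
qed

end

theory Submission
  imports Defs
begin

text \<open>
  A finite local ring has only the idempotents 0 and 1, so every \<open>(0, u)\<close> is adjacent to all other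
  vertices of the clean graph, while \<open>(1, u)\<close> and \<open>(1, v)\<close> are adjacent iff \<open>u\<close> and \<open>v\<close> are
  distinct mutual inverses. The diameter is therefore at most 2, so a vertex \<open>w\<close> other than \<open>x\<close>
  and \<open>y\<close> strongly resolves \<open>x\<close> and \<open>y\<close> only if one of \<open>x - y - w\<close>, \<open>y - x - w\<close> is a geodesic of
  length 2. This never happens when \<open>x\<close> and \<open>y\<close> have the same first component, hence a strong
  resolving set misses at most one vertex in each of the two layers. If there is a unit \<open>u \<noteq> 1\<close>,
  then \<open>(0, 1)\<close> and \<open>(1, 1)\<close> can be omitted simultaneously, because \<open>(1, u)\<close> resolves them.
\<close>

section \<open>Idempotents of a finite local ring\<close>

lemma (in ring) ex_maximalideal_superset:
  assumes fin: "finite (carrier R)" and I: "ideal I R" "I \<noteq> carrier R"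
  shows "\<exists>M. maximalideal M R \<and> I \<subseteq> M"
proof -
  let ?A = "{J. ideal J R \<and> I \<subseteq> J \<and> J \<noteq> carrier R}"
  have sub: "J \<subseteq> carrier R" if "ideal J R" for J
    using that by (rule ideal.Icarr[THEN subsetI])
  \<comment> \<open>Finiteness replaces Zorn's lemma: a finite nonempty family of proper ideals has
    a member maximal under inclusion.\<close>
  have "finite ?A"
    by (rule finite_subset[of _ "Pow (carrier R)"]) (use fin sub in auto)
  moreover have "?A \<noteq> {}"
    using I by blast
  ultimately obtain M where M: "M \<in> ?A" and max: "\<And>J. J \<in> ?A \<Longrightarrow> M \<subseteq> J \<Longrightarrow> M = J"
    using finite_has_maximal[of ?A] by auto
  have "maximalideal M R"
    by (rule maximalidealI) (use M max in blast)+
  with M show ?thesis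
    by blast
qed

text \<open>If the principal ideal of \<open>e\<close> contained
  \<open>\<one> = x \<otimes> e\<close>, multiplying by \<open>e\<close> would give
  \<open>e = \<one>\<close>. So this ideal is proper and extends to a maximal one.\<close>

lemma (in cring) idempotent_in_maximalideal:
  assumes fin: "finite (carrier R)" and e: "e \<in> idempotents R" "e \<noteq> \<one>"
  shows "\<exists>M. maximalideal M R \<and> e \<in> M"
proof -
  have ec: "e \<in> carrier R" and ee: "e \<otimes> e = e"
    using e by (auto simp: idempotents_def)
  have "\<one> \<notin> PIdl e"
  proof
    assume "\<one> \<in> PIdl e"
    then obtain x where x: "x \<in> carrier R" "\<one> = x \<otimes> e"
      by (auto simp: cgenideal_def)
    have "x \<otimes> e \<otimes> e = x \<otimes> e"
      using x ec ee by (simp add: m_assoc)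
    then show False
      using ec e(2) by (simp flip: x(2))
  qed
  then have "PIdl e \<noteq> carrier R"
    by auto
  then show ?thesis
    using ex_maximalideal_superset[OF fin cgenideal_ideal[OF ec]] cgenideal_self[OF ec] by blast
qed

lemma (in local_cring) zero_not_one_local: "\<zero> \<noteq> \<one>"
proof
  assume eq: "\<zero> = \<one>"
  obtain M where "maximalideal M R"
    using unique_maximalideal by blast
  then interpret M: maximalideal M R .
  have "carrier R = M"
    using M.one_imp_carrier M.zero_closed eq by simp
  then show False
    using M.I_notcarr by blast
qed

text \<open>For an idempotent \<open>e\<close> other than \<open>\<zero>\<close> and
  \<open>\<one>\<close>, both \<open>e\<close> and its complement \<open>\<one> \<ominus> e\<close>
  are idempotents different from \<open>\<one>\<close>, so each lies in a maximal ideal. By locality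
  the two ideals coincide, and the common one contains the sum \<open>\<one>\<close>.\<close>

lemma (in local_cring) idempotents_eq:
  assumes fin: "finite (carrier R)"
  shows "idempotents R = {\<zero>, \<one>}"
proof
  show "idempotents R \<subseteq> {\<zero>, \<one>}"
  proof (rule subsetI, rule ccontr)
    fix e assume e: "e \<in> idempotents R" and ne: "e \<notin> {\<zero>, \<one>}"
    have ec: "e \<in> carrier R" and ee: "e \<otimes> e = e"
      using e by (auto simp: idempotents_def)
    let ?f = "\<one> \<ominus> e"
    have "?f \<otimes> ?f = ?f"
      using ec ee by algebra
    then have f: "?f \<in> idempotents R"
      using ec by (simp add: idempotents_def)
    have sum: "e \<oplus> ?f = \<one>"
      using ec by algebra
    have "?f \<noteq> \<one>"
    proof
      assume "?f = \<one>"
      moreover have "e = \<one> \<ominus> ?f"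
        using ec by algebra
      ultimately show False
        using ne by (simp add: minus_eq r_neg)
    qed
    then obtain M N where "maximalideal M R" "e \<in> M" "maximalideal N R" "?f \<in> N"
      using idempotent_in_maximalideal[OF fin] e f ne by blast
    moreover from this have "N = M"
      using unique_maximalideal by blast
    ultimately have M: "maximalideal M R" "e \<in> M" "?f \<in> M"
      by auto
    then interpret M: maximalideal M R
      by simp
    have "\<one> \<in> M"
      using M.a_closed[OF M(2,3)] sum by simp
    then show False
      using M.one_imp_carrier M.I_notcarr by blast
  qed
qed (auto simp: idempotents_def)

section \<open>Geodesics and strong resolution in arbitrary digraphs\<close>

lemma strongly_resolves_commute: "strongly_resolves G w x y \<longleftrightarrow> strongly_resolves G w y x"
  by (auto simp: strongly_resolves_def)

lemma shortest_vpath_exists: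
  assumes "vpath q G" "hd q = x" "last q = y"
  shows "\<exists>p. shortest_vpath G x p y"
proof -
  let ?P = "\<lambda>p. vpath p G \<and> hd p = x \<and> last p = y"
  have "\<exists>p. ?P p \<and> (\<forall>r. ?P r \<longrightarrow> vwalk_length p \<le> vwalk_length r)"
    by (rule ex_has_least_nat[of ?P q]) (use assms in simp)
  then show ?thesis
    by (simp only: shortest_vpath_def conj_assoc)
qed

text \<open>Every geodesic from \<open>y\<close> to \<open>x\<close> contains its endpoint
  \<open>x\<close>, so reachability suffices. Hence a candidate set has to be tested only on pairs
  that it misses entirely.\<close>

lemma strongly_resolves_self:
  assumes "vpath q G" "hd q = y" "last q = x"
  shows "strongly_resolves G x x y"
proof -
  obtain p where p: "shortest_vpath G y p x"
    using shortest_vpath_exists[OF assms] ..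
  then have "x \<in> set p"
    by (auto simp: shortest_vpath_def vpath_def vwalk_def)
  with p show ?thesis
    by (auto simp: strongly_resolves_def)
qed

lemma shortest_vpath_two_arcs:
  assumes "(x, y) \<in> arcs_ends G" "(y, w) \<in> arcs_ends G" "(x, w) \<notin> arcs_ends G"
    and "distinct [x, y, w]" "{x, y, w} \<subseteq> verts G"
  shows "shortest_vpath G x [x, y, w] w"
  unfolding shortest_vpath_def
proof (intro conjI allI impI)
  show "vpath [x, y, w] G"
    using assms by (auto simp: vpath_def vwalk_def)
  fix q assume q: "vpath q G \<and> hd q = x \<and> last q = w"
  then obtain q' where q': "q = x # q'"
    by (cases q) (auto simp: vpath_def vwalk_def)
  with q assms(4) obtain z q'' where q'': "q' = z # q''"
    by (cases q') auto
  \<comment> \<open>Otherwise \<open>q\<close> would consist of the single missing arc from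
    \<open>x\<close> to \<open>w\<close>.\<close>
  with q q' assms(3) have "q'' \<noteq> []"
    by (auto simp: vpath_def vwalk_def)
  then show "vwalk_length [x, y, w] \<le> vwalk_length q"
    using q' q'' by (cases q'') auto
qed auto

text \<open>Converse of \<open>shortest_vpath_two_arcs\<close>: the competitor \<open>q\<close>
  leaves room for at most three vertices on \<open>p\<close>, so an interior \<open>y\<close> forces
  \<open>p = [x, y, w]\<close>, and an arc from \<open>x\<close> to \<open>w\<close> would be a
  shortcut.\<close>

lemma interior_shortest_vpath_length_two:
  assumes p: "shortest_vpath G x p w" and y: "y \<in> set p" "y \<noteq> x" "y \<noteq> w"
    and q: "vpath q G" "hd q = x" "last q = w" "length q \<le> 3"
  shows "(x, y) \<in> arcs_ends G \<and> (y, w) \<in> arcs_ends G \<and> (x, w) \<notin> arcs_ends G \<and> x \<noteq> w"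
proof -
  have path: "vpath p G" "hd p = x" "last p = w"
    and min: "\<And>r. vpath r G \<Longrightarrow> hd r = x \<Longrightarrow> last r = w \<Longrightarrow> length p - 1 \<le> length r - 1"
    using p by (auto simp: shortest_vpath_def)
  have "length p \<le> 3"
    using min[OF q(1-3)] q(4) by linarith
  moreover have "p \<noteq> []"
    using path(1) by (auto simp: vpath_def vwalk_def)
  ultimately have pxyw: "p = [x, y, w]"
    using path(2,3) y by (auto simp: neq_Nil_conv le_Suc_eq numeral_3_eq_3 length_Suc_conv)
  then have arcs: "(x, y) \<in> arcs_ends G" "(y, w) \<in> arcs_ends G" "x \<noteq> w" "x \<in> verts G" "w \<in> verts G"
    using path(1) by (auto simp: vpath_def vwalk_def)
  have "(x, w) \<notin> arcs_ends G"
  proof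
    assume "(x, w) \<in> arcs_ends G"
    then have "vpath [x, w] G"
      using arcs by (auto simp: vpath_def vwalk_def)
    from min[OF this] show False
      using pxyw by simp
  qed
  with arcs show ?thesis
    by blast
qed

lemma sdim_eqI:
  assumes "strong_resolving_set G S" "finite S" "card S = k"
    and "\<And>T. strong_resolving_set G T \<Longrightarrow> finite T \<Longrightarrow> k \<le> card T"
  shows "sdim G = k"
  unfolding sdim_def by (rule Least_equality) (use assms in auto)

section \<open>Distances and resolution in the clean graph\<close>

locale finite_local_cring = local_cring +
  assumes finite_carrier: "finite (carrier R)"
begin

text \<open>The graph stays expressed through \<open>verts\<close> and \<open>arcs_ends\<close>, as
  in the facts on general digraphs.\<close>

declare with_proj_simps [simp del]

abbreviation Cl :: "('a \<times> 'a, ('a \<times> 'a) \<times> ('a \<times> 'a)) pre_digraph" where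
  "Cl \<equiv> with_proj (clean_graph R)"

lemma finite_Units: "finite (Units R)"
  using finite_carrier by (auto simp: Units_def)

lemma verts_Cl: "verts Cl = {\<zero>, \<one>} \<times> Units R"
  by (simp add: with_proj_simps clean_graph_def idempotents_eq[OF finite_carrier])

lemma card_verts_Cl: "card (verts Cl) = 2 * card (Units R)"
  using zero_not_one_local by (simp add: verts_Cl card_cartesian_product)

lemma arcs_ends_Cl:
  "((e, u), (f, v)) \<in> arcs_ends Cl \<longleftrightarrow>
    e \<in> {\<zero>, \<one>} \<and> f \<in> {\<zero>, \<one>} \<and> u \<in> Units R \<and> v \<in> Units R \<and> (e, u) \<noteq> (f, v) \<and>
    (e = \<zero> \<or> f = \<zero> \<or> u \<otimes> v = \<one>)"
  using zero_not_one_local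
  by (auto simp: with_proj_simps clean_graph_def idempotents_eq[OF finite_carrier])

lemma short_vpath_Cl:
  assumes "x \<in> verts Cl" "y \<in> verts Cl"
  shows "\<exists>q. vpath q Cl \<and> hd q = x \<and> last q = y \<and> length q \<le> 3"
proof -
  obtain e u f v where xy: "x = (e, u)" "y = (f, v)"
    by fastforce
  consider "x = y" | "x \<noteq> y" "(x, y) \<in> arcs_ends Cl" | "x \<noteq> y" "(x, y) \<notin> arcs_ends Cl"
    by blast
  then show ?thesis
  proof cases
    case 1
    then show ?thesis
      using assms by (intro exI[of _ "[x]"]) (simp add: vpath_self)
  next
    case 2
    then show ?thesis
      using assms by (intro exI[of _ "[x, y]"]) (auto simp: vpath_def vwalk_def)
  next
    case 3
    have c: "(\<zero>, \<one>) \<in> verts Cl"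
      by (simp add: verts_Cl)
    \<comment> \<open>Vertices with first component \<open>\<zero>\<close> are adjacent to all
      others, so a non-adjacent pair lies in the other layer and has
      \<open>(\<zero>, \<one>)\<close> as a common neighbour.\<close>
    have ef: "e \<noteq> \<zero>" "f \<noteq> \<zero>"
      using 3 assms by (auto simp: xy arcs_ends_Cl verts_Cl)
    then have "(x, (\<zero>, \<one>)) \<in> arcs_ends Cl" "((\<zero>, \<one>), y) \<in> arcs_ends Cl"
      using assms by (auto simp: xy arcs_ends_Cl verts_Cl)
    then show ?thesis
      using 3 c ef assms
      by (intro exI[of _ "[x, (\<zero>, \<one>), y]"]) (auto simp: vpath_def vwalk_def xy)
  qed
qed

lemma strongly_resolves_self_Cl:
  assumes "x \<in> verts Cl" "y \<in> verts Cl"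
  shows "strongly_resolves Cl x x y"
  using short_vpath_Cl[OF assms(2,1)] by (metis strongly_resolves_self)

text \<open>If \<open>e\<close> or the first component of \<open>w\<close> were
  \<open>\<zero>\<close>, then \<open>(e, u)\<close> would be adjacent to \<open>w\<close>. With
  both equal to \<open>\<one>\<close>, the two arcs make \<open>v\<close> inverse to the units of
  both ends, so the ends coincide.\<close>

lemma geodesic_changes_layer:
  assumes "((e, u), (e, v)) \<in> arcs_ends Cl" "((e, v), w) \<in> arcs_ends Cl"
    and "((e, u), w) \<notin> arcs_ends Cl" "(e, u) \<noteq> w"
  shows False
proof -
  obtain f t where w: "w = (f, t)"
    by fastforce
  have units: "u \<in> Units R" "v \<in> Units R" "t \<in> Units R"
    using assms by (auto simp: w arcs_ends_Cl)
  have e: "e = \<one>" "f = \<one>"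
    using assms by (auto simp: w arcs_ends_Cl)
  then have "u \<otimes> v = \<one>" "v \<otimes> t = \<one>"
    using assms zero_not_one_local by (auto simp: w arcs_ends_Cl)
  then have "u = t"
    using units by (metis Units_closed inv_unique m_comm)
  then show False
    using assms(4) e w by simp
qed

lemma strongly_resolves_same_layer:
  assumes xy: "(e, u) \<in> verts Cl" "(e, v) \<in> verts Cl" and "w \<in> verts Cl"
    and "strongly_resolves Cl w (e, u) (e, v)" and "u \<noteq> v"
  shows "w = (e, u) \<or> w = (e, v)"
proof (rule ccontr)
  assume w: "\<not> ?thesis"
  \<comment> \<open>Stated for arbitrary \<open>a\<close> and \<open>b\<close> to cover both
    alternatives of \<open>strongly_resolves_def\<close>.\<close>
  have False if p: "shortest_vpath Cl (e, a) p w" "(e, b) \<in> set p"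
    and ab: "a \<noteq> b" "(e, a) \<in> verts Cl" "w \<noteq> (e, b)" for a b p
  proof -
    obtain q where q: "vpath q Cl" "hd q = (e, a)" "last q = w" "length q \<le> 3"
      using short_vpath_Cl[OF ab(2) assms(3)] by blast
    show False
      using interior_shortest_vpath_length_two[OF p _ _ q] ab geodesic_changes_layer[of e a b w]
      by auto
  qed
  then show False
    using assms w unfolding strongly_resolves_def by metis
qed

section \<open>The lower bound and the sets attaining it\<close>

lemma card_strong_resolving_set_ge:
  assumes S: "strong_resolving_set Cl S"
  shows "2 * card (Units R) - 2 \<le> card S"
proof -
  have sub: "S \<subseteq> verts Cl"
    using S by (simp add: strong_resolving_set_def)
  have finV: "finite (verts Cl)"
    using finite_Units by (simp add: verts_Cl)
  \<comment> \<open>Two omitted vertices of one layer could be resolved only by one of themselves,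
    which is not in \<open>S\<close>.\<close>
  have layer: "card {u \<in> Units R. (e, u) \<notin> S} \<le> Suc 0" if e: "e \<in> {\<zero>, \<one>}" for e
  proof -
    have "u = v" if "u \<in> Units R" "(e, u) \<notin> S" "v \<in> Units R" "(e, v) \<notin> S" for u v
    proof (rule ccontr)
      assume "u \<noteq> v"
      moreover have "(e, u) \<in> verts Cl" "(e, v) \<in> verts Cl"
        using that e by (simp_all add: verts_Cl)
      ultimately obtain w where "w \<in> S" "strongly_resolves Cl w (e, u) (e, v)"
        using S unfolding strong_resolving_set_def by blast
      then have "w = (e, u) \<or> w = (e, v)"
        using strongly_resolves_same_layer \<open>(e, u) \<in> verts Cl\<close> \<open>(e, v) \<in> verts Cl\<close> \<open>u \<noteq> v\<close> sub
        by blast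
      with \<open>w \<in> S\<close> that show False
        by blast
    qed
    then show ?thesis
      using finite_Units by (subst card_le_Suc0_iff_eq) auto
  qed
  have "verts Cl - S \<subseteq> (\<Union>e\<in>{\<zero>, \<one>}. Pair e ` {u \<in> Units R. (e, u) \<notin> S})"
    by (auto simp: verts_Cl)
  then have "card (verts Cl - S) \<le> card (\<Union>e\<in>{\<zero>, \<one>}. Pair e ` {u \<in> Units R. (e, u) \<notin> S})"
    using finite_Units by (intro card_mono) auto
  also have "\<dots> \<le> (\<Sum>e\<in>{\<zero>, \<one>}. card (Pair e ` {u \<in> Units R. (e, u) \<notin> S}))"
    by (rule card_UN_le) simp
  also have "\<dots> \<le> (\<Sum>e\<in>{\<zero>, \<one>}. Suc 0)"
    by (intro sum_mono order_trans[OF card_image_le layer]) (use finite_Units in auto)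
  also have "\<dots> = 2"
    using zero_not_one_local by simp
  finally have "card (verts Cl) - card S \<le> 2"
    using card_Diff_subset[OF finite_subset[OF sub finV] sub] by simp
  then show ?thesis
    unfolding card_verts_Cl by linarith
qed

text \<open>The bound \<open>2 * card (Units R) - 2\<close> is 0 here and not attained: there are
  two vertices, and the empty set resolves nothing.\<close>

lemma sdim_Cl_trivial_units:
  assumes "card (Units R) = 1"
  shows "sdim Cl = 1"
proof (rule sdim_eqI)
  have "Units R = {\<one>}"
    using assms Units_one_closed by (metis card_1_singletonE singletonD)
  then have V: "verts Cl = {(\<zero>, \<one>), (\<one>, \<one>)}"
    unfolding verts_Cl by auto
  show "strong_resolving_set Cl {(\<zero>, \<one>)}"
    unfolding strong_resolving_set_def V
    using strongly_resolves_self_Cl[of "(\<zero>, \<one>)" "(\<one>, \<one>)"] V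
      strongly_resolves_commute[of Cl "(\<zero>, \<one>)" "(\<zero>, \<one>)" "(\<one>, \<one>)"]
    by auto
  show "1 \<le> card T" if T: "strong_resolving_set Cl T" "finite T" for T
  proof -
    have "T \<noteq> {}"
      using T(1) zero_not_one_local unfolding strong_resolving_set_def V by blast
    then show ?thesis
      using T(2) by (simp add: Suc_le_eq card_gt_0_iff)
  qed
qed auto

lemma sdim_Cl_nontrivial_units:
  assumes two: "card (Units R) \<ge> 2"
  shows "sdim Cl = 2 * card (Units R) - 2"
proof (rule sdim_eqI)
  let ?O = "{(\<zero>, \<one>), (\<one>, \<one>)}"
  let ?S = "verts Cl - ?O"
  have O: "?O \<subseteq> verts Cl"
    by (auto simp: verts_Cl)
  have "\<not> Units R \<subseteq> {\<one>}"
    using card_mono[of "{\<one>}" "Units R"] two by auto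
  then obtain u where u: "u \<in> Units R" "u \<noteq> \<one>"
    by blast
  \<comment> \<open>Since \<open>u \<noteq> \<one>\<close>, the product of \<open>\<one>\<close> and
    \<open>u\<close> is not \<open>\<one>\<close>, so the two ends are not adjacent.\<close>
  have "shortest_vpath Cl (\<one>, \<one>) [(\<one>, \<one>), (\<zero>, \<one>), (\<one>, u)] (\<one>, u)"
    by (rule shortest_vpath_two_arcs)
      (use u zero_not_one_local in \<open>auto simp: arcs_ends_Cl verts_Cl\<close>)
  then have res: "strongly_resolves Cl (\<one>, u) (\<one>, \<one>) (\<zero>, \<one>)"
    unfolding strongly_resolves_def by force
  have uS: "(\<one>, u) \<in> ?S"
    using u zero_not_one_local by (auto simp: verts_Cl)
  show "strong_resolving_set Cl ?S"
    unfolding strong_resolving_set_def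
  proof (intro conjI ballI impI)
    fix x y assume xy: "x \<in> verts Cl" "y \<in> verts Cl" "x \<noteq> y"
    \<comment> \<open>A pair meeting \<open>?S\<close> is resolved by its own member; the only
      remaining pair is \<open>?O\<close>, resolved by \<open>(\<one>, u)\<close>.\<close>
    consider "x \<in> ?S" | "y \<in> ?S" | "x \<in> ?O" "y \<in> ?O"
      using xy by blast
    then show "\<exists>w\<in>?S. strongly_resolves Cl w x y"
    proof cases
      case 1
      then show ?thesis
        using strongly_resolves_self_Cl[OF xy(1,2)] by blast
    next
      case 2
      then show ?thesis
        using strongly_resolves_self_Cl[OF xy(2,1)] strongly_resolves_commute[of Cl y x y] by blast
    next
      case 3
      then show ?thesis
        using res uS xy(3) strongly_resolves_commute[of Cl "(\<one>, u)" x y] by auto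
    qed
  qed blast
  show "finite ?S"
    using finite_Units by (simp add: verts_Cl)
  show "card ?S = 2 * card (Units R) - 2"
    using card_Diff_subset[OF _ O] zero_not_one_local card_verts_Cl by simp
qed (rule card_strong_resolving_set_ge)

end

theorem theorem4p6:
  fixes R :: "('a, 'b) ring_scheme"
  assumes "local_cring R" and "finite (carrier R)"
  shows "(card (Units R) = 1 \<longrightarrow> sdim (with_proj (clean_graph R)) = 1) \<and>
    (card (Units R) \<ge> 2 \<longrightarrow> sdim (with_proj (clean_graph R)) = 2 * card (Units R) - 2)"
proof -
  interpret finite_local_cring R
    using assms by (simp add: finite_local_cring_def finite_local_cring_axioms_def)
  show ?thesis
    using sdim_Cl_trivial_units sdim_Cl_nontrivial_units by blast
qed

end
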